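(* Let $H$ be a nonzero separable real or complex Hilbert space. Then $H$ is finite-dimensional if and only if for all bounded linear operators $T, A$ on $H$, $T \perp_B A$ (with respect to the operator norm) implies $\mathcal{O}_{T,A} \neq \emptyset$.
   Context: In a normed space over $\mathbb{K} \in \{\mathbb{R}, \mathbb{C}\}$, $x$ is Birkhoff-James orthogonal to $y$, written $x \perp_B y$, if $\|x\| \le \|x + \lambda y\|$ for all $\lambda \in \mathbb{K}$. For bounded linear operators $T, A$ on $H$, $\mathcal{O}_{T,A} = \{x \in S_H : Tx \perp_B Ax\}$, where $S_H = \{x \in H: \|x\| = 1\}$ (in a Hilbert space, $Tx \perp_B Ax$ means $\langle Tx, Ax\rangle = 0$). *)

theory Defs
  imports "HOL-Analysis.Analysis"
begin

class complex_vector = real_vector +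
  fixes scaleC :: "complex \<Rightarrow> 'a \<Rightarrow> 'a"  (infixr \<open>*\<^sub>C\<close> 75)
  assumes scaleC_add_right: "a *\<^sub>C (x + y) = a *\<^sub>C x + a *\<^sub>C y"
    and scaleC_add_left: "(a + b) *\<^sub>C x = a *\<^sub>C x + b *\<^sub>C x"
    and scaleC_scaleC: "a *\<^sub>C b *\<^sub>C x = (a * b) *\<^sub>C x"
    and scaleC_one: "1 *\<^sub>C x = x"
    and scaleR_scaleC: "r *\<^sub>R x = complex_of_real r *\<^sub>C x"

lemma vector_space_scaleC: "vector_space ((*\<^sub>C) :: complex \<Rightarrow> 'a::complex_vector \<Rightarrow> 'a)"
  by unfold_locales (simp_all add: scaleC_add_right scaleC_add_left scaleC_scaleC scaleC_one)

class complex_normed_vector = complex_vector + real_normed_vector +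
  assumes norm_scaleC: "norm (a *\<^sub>C x) = cmod a * norm x"

class complex_inner = complex_normed_vector +
  fixes cinner :: "'a \<Rightarrow> 'a \<Rightarrow> complex"
  assumes cinner_commute: "cinner x y = cnj (cinner y x)"
    and cinner_add_left: "cinner (x + y) z = cinner x z + cinner y z"
    and cinner_scaleC_left: "cinner (a *\<^sub>C x) y = a * cinner x y"
    and cinner_self: "cinner x x = complex_of_real ((norm x)\<^sup>2)"

instantiation complex :: complex_inner
begin

definition scaleC_complex :: "complex \<Rightarrow> complex \<Rightarrow> complex"
  where "scaleC_complex a x = a * x"

definition cinner_complex :: "complex \<Rightarrow> complex \<Rightarrow> complex"
  where "cinner_complex x y = x * cnj y"

instance
  by standard
    (auto simp: scaleC_complex_def cinner_complex_def algebra_simps norm_mult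
      scaleR_conv_of_real simp flip: complex_norm_square)

end

text \<open>
  An element of \<^typ>\<open>'a \<Rightarrow>\<^sub>L 'b\<close> is a bounded real-linear map.  The bounded complex-linear maps
  are those that also satisfy \<open>Vector_Spaces.linear (*\<^sub>C) (*\<^sub>C)\<close>; their operator norm is the
  norm of \<^typ>\<open>'a \<Rightarrow>\<^sub>L 'b\<close>, and their complex multiples are the pointwise ones below.
\<close>

instantiation blinfun :: (real_normed_vector, complex_normed_vector) complex_normed_vector
begin

lift_definition scaleC_blinfun :: "complex \<Rightarrow> ('a \<Rightarrow>\<^sub>L 'b) \<Rightarrow> ('a \<Rightarrow>\<^sub>L 'b)"
  is "\<lambda>c f x. c *\<^sub>C f x"
proof -
  fix c :: complex and f :: "'a \<Rightarrow> 'b"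
  assume f: "bounded_linear f"
  have "bounded_linear ((*\<^sub>C) c :: 'b \<Rightarrow> 'b)"
    by (rule bounded_linear_intro[where K = "cmod c"])
      (simp_all add: scaleC_add_right scaleR_scaleC scaleC_scaleC norm_scaleC mult.commute)
  from bounded_linear_compose[OF this f] show "bounded_linear (\<lambda>x. c *\<^sub>C f x)" .
qed

instance
proof
  fix a b :: complex and r :: real and f g :: "'a \<Rightarrow>\<^sub>L 'b"
  show "a *\<^sub>C (f + g) = a *\<^sub>C f + a *\<^sub>C g"
    by transfer (simp add: scaleC_add_right)
  show "(a + b) *\<^sub>C f = a *\<^sub>C f + b *\<^sub>C f"
    by transfer (simp add: scaleC_add_left)
  show "a *\<^sub>C b *\<^sub>C f = (a * b) *\<^sub>C f"
    by transfer (simp add: scaleC_scaleC)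
  show "1 *\<^sub>C f = f"
    by transfer (simp add: scaleC_one)
  show "r *\<^sub>R f = complex_of_real r *\<^sub>C f"
    by transfer (simp add: scaleR_scaleC)
  have le: "norm (c *\<^sub>C h) \<le> cmod c * norm h" for c and h :: "'a \<Rightarrow>\<^sub>L 'b"
  proof (rule norm_blinfun_bound)
    show "norm ((c *\<^sub>C h) x) \<le> cmod c * norm h * norm x" for x
      using mult_left_mono[OF norm_blinfun[of h x], of "cmod c"]
      by (simp add: scaleC_blinfun.rep_eq norm_scaleC mult.assoc)
  qed simp
  show "norm (a *\<^sub>C f) = cmod a * norm f"
  proof (cases "a = 0")
    case True
    with le[of 0 f] show ?thesis by simp
  next
    case False
    have "f = inverse a *\<^sub>C a *\<^sub>C f"
      using False by transfer (simp add: scaleC_scaleC scaleC_one)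
    then have "norm f \<le> inverse (cmod a) * norm (a *\<^sub>C f)"
      using le[of "inverse a" "a *\<^sub>C f"] by (simp add: norm_inverse)
    with False have "cmod a * norm f \<le> norm (a *\<^sub>C f)"
      by (simp add: field_simps)
    with le[of a f] show ?thesis by simp
  qed
qed

end

text \<open>
  In the next two definitions the scalar field is the type \<^typ>\<open>'k\<close> of the coefficients of
  \<open>sm\<close>: they are used with \<open>(*\<^sub>R)\<close> for real and \<open>(*\<^sub>C)\<close> for complex spaces.
\<close>

definition birkhoff_james_orthogonal ::
    "('k \<Rightarrow> 'v \<Rightarrow> 'v) \<Rightarrow> 'v::real_normed_vector \<Rightarrow> 'v \<Rightarrow> bool"
  where "birkhoff_james_orthogonal sm x y \<longleftrightarrow> (\<forall>c. norm x \<le> norm (x + sm c y))"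

definition orthogonality_set ::
    "('k \<Rightarrow> 'v \<Rightarrow> 'v) \<Rightarrow> ('v::real_normed_vector \<Rightarrow>\<^sub>L 'v) \<Rightarrow> ('v \<Rightarrow>\<^sub>L 'v) \<Rightarrow> 'v set"
  where "orthogonality_set sm T A =
    {x \<in> sphere 0 1. birkhoff_james_orthogonal sm (T x) (A x)}"

definition finite_dimensional :: "('k::field \<Rightarrow> 'v \<Rightarrow> 'v::ab_group_add) \<Rightarrow> bool"
  where "finite_dimensional sm \<longleftrightarrow> (\<exists>B. finite_dimensional_vector_space sm B)"

end

theory Submission
  imports Defs
begin

text \<open>
  Finite-dimensional spaces: the set of all \<open>\<langle>T x, A x\<rangle>\<close> with \<open>\<parallel>x\<parallel> = 1\<close> is compact and, by the
  Toeplitz-Hausdorff argument, convex.  If it misses \<open>0\<close>, a separating functional yields a scalar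
  \<open>c\<close> with \<open>\<parallel>T + c A\<parallel> < \<parallel>T\<parallel>\<close>, so \<open>T\<close> is not orthogonal to \<open>A\<close>.

  Infinite-dimensional spaces: let \<open>T\<close> be the identity and \<open>A x\<close> a weighted sum of the
  \<open>\<langle>x, d n\<rangle> d n\<close> for a dense sequence \<open>d\<close>.  Then \<open>\<langle>x, A x\<rangle> > 0\<close> for \<open>x \<noteq> 0\<close> by density, but \<open>\<parallel>A x\<parallel>\<close>
  is small for unit vectors \<open>x\<close> orthogonal to many \<open>d n\<close>, so \<open>\<parallel>T + c A\<parallel> \<ge> 1\<close> for all \<open>c\<close>.
\<close>

section \<open>Hilbert spaces over the real or complex numbers\<close>

text \<open>
  The assumptions on the conjugation \<open>cj\<close> are met by the identity on the reals and by \<open>cnj\<close> on the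
  complex numbers, so that both fields are treated at once.  The Euclidean structure of the scalars
  serves to separate convex sets of scalars.
\<close>

locale hilbert_space = vector_space sm
  for sm :: "'k::{real_normed_field,euclidean_space} \<Rightarrow> 'v::{real_normed_vector,complete_space} \<Rightarrow> 'v"
    (infixr \<open>\<odot>\<close> 75) +
  fixes cj :: "'k \<Rightarrow> 'k" and ip :: "'v \<Rightarrow> 'v \<Rightarrow> 'k"
  assumes cj_add: "cj (a + b) = cj a + cj b"
    and cj_mult: "cj (a * b) = cj a * cj b"
    and cj_cj: "cj (cj a) = a"
    and mult_cj: "a * cj a = of_real ((norm a)\<^sup>2)"
    and cj_fixed: "cj a = a \<Longrightarrow> a \<in> \<real>"
    and ip_commute: "ip x y = cj (ip y x)"
    and ip_add_left: "ip (x + y) z = ip x z + ip y z"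
    and ip_scale_left: "ip (c \<odot> x) y = c * ip x y"
    and ip_self: "ip x x = of_real ((norm x)\<^sup>2)"
    and norm_scale: "norm (c \<odot> x) = norm c * norm x"
    and scaleR_eq_scale: "r *\<^sub>R x = of_real r \<odot> x"
begin

lemma ip_add_right: "ip x (y + z) = ip x y + ip x z"
  by (metis ip_commute ip_add_left cj_add)

lemma ip_scale_right: "ip x (c \<odot> y) = cj c * ip x y"
  by (metis ip_commute ip_scale_left cj_mult)

lemma cj_0: "cj 0 = 0"
  using cj_add[of 0 0] by simp

lemma norm_cj: "norm (cj a) = norm a"
proof (cases "a = 0")
  case False
  have "norm a * norm (cj a) = norm a * norm a"
    using arg_cong[OF mult_cj[of a], of norm] by (simp add: norm_mult power2_eq_square)
  with False show ?thesis by simp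
qed (simp add: cj_0)

lemma cj_of_real: "cj (of_real r) = of_real r"
proof (cases "r = 0")
  case False
  have "of_real r * cj (of_real r) = (of_real r * of_real r :: 'k)"
    by (simp add: mult_cj power2_eq_square)
  with False show ?thesis by simp
qed (simp add: cj_0)

text \<open>Expanding \<open>(a + b) * cj (a + b)\<close> both algebraically and as a squared
  Euclidean norm gives the cross term. This ties the field structure of the scalars to their real
  inner product, so that real separation arguments apply to values of \<open>ip\<close>.\<close>

lemma mult_cj_polarization: "a * cj b + b * cj a = of_real (2 * (a \<bullet> b))"
proof -
  have "(a + b) * cj (a + b) = of_real ((norm a)\<^sup>2 + 2 * (a \<bullet> b) + (norm b)\<^sup>2)"
    unfolding mult_cj power2_norm_eq_inner by (simp add: inner_add inner_commute)
  moreover have "(a + b) * cj (a + b) = a * cj a + (a * cj b + b * cj a) + b * cj b"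
    by (simp add: cj_add algebra_simps)
  ultimately show ?thesis
    by (simp add: mult_cj)
qed

lemma norm_add_scale_power2:
  "(norm (u + c \<odot> v))\<^sup>2 = (norm u)\<^sup>2 + 2 * (c \<bullet> ip u v) + (norm c)\<^sup>2 * (norm v)\<^sup>2"
proof -
  have "of_real ((norm (u + c \<odot> v))\<^sup>2) = ip (u + c \<odot> v) (u + c \<odot> v)"
    by (simp add: ip_self)
  also have "\<dots> = ip u u + (c * cj (ip u v) + ip u v * cj c) + (c * cj c) * ip v v"
    using ip_commute[of v u]
    by (simp add: ip_add_left ip_add_right ip_scale_left ip_scale_right algebra_simps)
  also have "\<dots> = of_real ((norm u)\<^sup>2 + 2 * (c \<bullet> ip u v) + (norm c)\<^sup>2 * (norm v)\<^sup>2)"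
    by (simp add: ip_self mult_cj_polarization mult_cj)
  finally show ?thesis
    by (simp only: of_real_eq_iff)
qed

text \<open>The chosen coefficient minimizes the quadratic \<open>norm_add_scale_power2\<close> in
  \<open>c\<close>. That the minimum is nonnegative is Cauchy-Schwarz; that it falls below the
  square of \<open>norm u\<close> unless \<open>ip u v = 0\<close> gives the criterion for
  Birkhoff-James orthogonality.\<close>

lemma norm_sub_projection_power2:
  assumes "v \<noteq> 0"
  shows "(norm (u + (- (1 / (norm v)\<^sup>2) *\<^sub>R ip u v) \<odot> v))\<^sup>2
    = (norm u)\<^sup>2 - (norm (ip u v))\<^sup>2 / (norm v)\<^sup>2"
proof -
  have "(norm (ip u v))\<^sup>2 = ip u v \<bullet> ip u v"
    by (rule power2_norm_eq_inner)
  with assms show ?thesis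
    unfolding norm_add_scale_power2
    by (simp add: field_simps power2_eq_square)
qed

lemma Cauchy_Schwarz: "norm (ip u v) \<le> norm u * norm v"
proof (cases "v = 0")
  case True
  then show ?thesis
    using ip_scale_right[of u 0 0] by (simp add: cj_0)
next
  case False
  have "0 \<le> (norm u)\<^sup>2 - (norm (ip u v))\<^sup>2 / (norm v)\<^sup>2"
    unfolding norm_sub_projection_power2[OF False, symmetric] by simp
  with False have "(norm (ip u v))\<^sup>2 \<le> (norm u * norm v)\<^sup>2"
    by (simp add: field_simps power_mult_distrib)
  then show ?thesis
    by (rule power2_le_imp_le) simp
qed

lemma birkhoff_james_orthogonal_iff: "birkhoff_james_orthogonal sm u v \<longleftrightarrow> ip u v = 0"
proof
  assume bj: "birkhoff_james_orthogonal sm u v"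
  show "ip u v = 0"
  proof (cases "v = 0")
    case True
    then show ?thesis using Cauchy_Schwarz[of u v] by simp
  next
    case False
    have "(norm u)\<^sup>2 \<le> (norm u)\<^sup>2 - (norm (ip u v))\<^sup>2 / (norm v)\<^sup>2"
      unfolding norm_sub_projection_power2[OF False, symmetric]
      using bj unfolding birkhoff_james_orthogonal_def by (intro power_mono norm_ge_zero) blast
    with False show ?thesis by (simp add: field_simps)
  qed
next
  assume "ip u v = 0"
  then show "birkhoff_james_orthogonal sm u v"
    unfolding birkhoff_james_orthogonal_def
    by (intro allI power2_le_imp_le[OF _ norm_ge_zero]) (simp add: norm_add_scale_power2)
qed

lemma bounded_linear_scale_left: "bounded_linear (\<lambda>c. c \<odot> x)"
  by (rule bounded_linear_intro[where K = "norm x"])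
    (simp_all add: scale_left_distrib scaleR_eq_scale norm_scale scaleR_conv_of_real)

lemma bounded_linear_scale_right: "bounded_linear ((\<odot>) c)"
  by (rule bounded_linear_intro[where K = "norm c"])
    (simp_all add: scale_right_distrib scaleR_eq_scale norm_scale mult.commute)

lemma bounded_bilinear_ip: "bounded_bilinear ip"
proof
  show "\<exists>K. \<forall>a b. norm (ip a b) \<le> norm a * norm b * K"
    using Cauchy_Schwarz by (intro exI[of _ 1]) simp
qed (simp_all add: ip_add_left ip_add_right scaleR_eq_scale ip_scale_left ip_scale_right
      cj_of_real scaleR_conv_of_real)

section \<open>Convexity of the numerical range\<close>

lemma unimodular_rotation_to_real:
  obtains \<theta> r where "norm \<theta> = 1" "\<theta> * a + cj \<theta> * b = of_real r"
proof -
  \<comment> \<open>\<open>\<theta> * a + cj \<theta> * b\<close> differs from its conjugate by \<open>\<theta> * w - cj (\<theta> * w)\<close>, so it suffices to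
    make \<open>\<theta> * w\<close> real.\<close>
  define w where "w = a - cj b"
  define \<theta> where "\<theta> = (if w = 0 then 1 else cj w / of_real (norm w))"
  have "norm \<theta> = 1"
    by (simp add: \<theta>_def norm_divide norm_cj)
  have "\<theta> * w = of_real (norm w)"
    using mult_cj[of w] by (auto simp: \<theta>_def power2_eq_square field_simps)
  then have eq: "cj \<theta> * cj w = \<theta> * w"
    by (metis cj_mult cj_of_real)
  have "cj w = cj a - b"
    using cj_add[of w "cj b"] by (simp add: w_def cj_cj)
  with eq have "cj \<theta> * (cj a - b) = \<theta> * (a - cj b)"
    by (simp only: w_def)
  then have "cj (\<theta> * a + cj \<theta> * b) = \<theta> * a + cj \<theta> * b"
    by (simp add: cj_add cj_mult cj_cj algebra_simps)
  then obtain r where "\<theta> * a + cj \<theta> * b = of_real r"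
    using cj_fixed by (auto elim: Reals_cases)
  with \<open>norm \<theta> = 1\<close> show ?thesis by (rule that)
qed

text \<open>Rotating \<open>x\<close> by a unimodular scalar makes the cross terms of
  \<open>F\<close> real without changing \<open>F x x = 0\<close>. The form is then real along the
  segment from the rotated \<open>x\<close> to \<open>y\<close>, and after normalization the
  intermediate value theorem applies.\<close>

lemma sesquilinear_attains_unit_interval:
  fixes F :: "'v \<Rightarrow> 'v \<Rightarrow> 'k"
  assumes add_left: "\<And>x y z. F (x + y) z = F x z + F y z"
    and add_right: "\<And>x y z. F x (y + z) = F x y + F x z"
    and scale_left: "\<And>c x y. F (c \<odot> x) y = c * F x y"
    and scale_right: "\<And>c x y. F x (c \<odot> y) = cj c * F x y"
    and "norm x = 1" "norm y = 1" "F x x = 0" "F y y = 1" "0 \<le> s" "s \<le> 1"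
  shows "\<exists>u. norm u = 1 \<and> F u u = of_real s"
proof -
  obtain \<theta> r where \<theta>: "norm \<theta> = 1" and r: "\<theta> * F x y + cj \<theta> * F y x = of_real r"
    by (rule unimodular_rotation_to_real)
  define x' where "x' = \<theta> \<odot> x"
  have scaleR: "F (a *\<^sub>R v) w = of_real a * F v w" "F v (a *\<^sub>R w) = of_real a * F v w" for a v w
    by (simp_all add: scaleR_eq_scale scale_left scale_right cj_of_real)
  have x': "norm x' = 1" "F x' x' = 0" "F x' y + F y x' = of_real r"
    using assms \<theta> r by (simp_all add: x'_def norm_scale scale_left scale_right)
  define z where "z = (\<lambda>t. (1 - t) *\<^sub>R x' + t *\<^sub>R y)"
  have Fz: "F (z t) (z t) = of_real (t * (1 - t) * r + t\<^sup>2)" for t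
  proof -
    have "F (z t) (z t) = of_real (t * (1 - t)) * (F x' y + F y x') + of_real (t\<^sup>2)"
      using x'(2) \<open>F y y = 1\<close>
      by (simp only: z_def add_left add_right scaleR)
        (simp add: algebra_simps power2_eq_square)
    then show ?thesis
      using x' by simp
  qed
  \<comment> \<open>If \<open>z t = 0\<close>, then \<open>(1 - t) *\<^sub>R x'\<close> and
    \<open>(- t) *\<^sub>R y\<close> coincide, but \<open>F\<close> takes the values 0 and
    \<open>t\<^sup>2\<close> on them. So \<open>t = 0\<close>, which makes \<open>x'\<close>
    zero.\<close>
  have z_nz: "z t \<noteq> 0" for t
  proof
    assume "z t = 0"
    then have eq: "(1 - t) *\<^sub>R x' = (- t) *\<^sub>R y"
      by (simp add: z_def eq_neg_iff_add_eq_0)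
    have "F ((1 - t) *\<^sub>R x') ((1 - t) *\<^sub>R x') = 0"
      by (simp only: scaleR x') simp
    moreover have "F ((- t) *\<^sub>R y) ((- t) *\<^sub>R y) = of_real (t\<^sup>2)"
      by (simp only: scaleR \<open>F y y = 1\<close>) (simp add: power2_eq_square)
    ultimately have "t = 0"
      by (simp add: eq)
    with eq x' show False by simp
  qed
  \<comment> \<open>The value of \<open>F\<close> at the unit vector in the direction of
    \<open>z t\<close>. It runs continuously from 0 at \<open>t = 0\<close> to 1 at
    \<open>t = 1\<close>.\<close>
  define g where "g = (\<lambda>t. (t * (1 - t) * r + t\<^sup>2) / (norm (z t))\<^sup>2)"
  have "continuous_on {0..1} g"
    unfolding g_def using z_nz unfolding z_def by (intro continuous_intros) auto
  moreover have "g 0 \<le> s" "s \<le> g 1"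
    using assms x' by (simp_all add: g_def z_def)
  ultimately obtain t where t: "g t = s"
    using IVT'[of g 0 s 1] by auto
  define u where "u = (1 / norm (z t)) *\<^sub>R z t"
  have "norm u = 1"
    using z_nz by (simp add: u_def)
  moreover have "F u u = of_real (g t)"
    by (simp only: u_def scaleR Fz g_def) (simp add: power2_eq_square field_simps)
  ultimately show ?thesis
    using t by blast
qed

lemma Toeplitz_Hausdorff:
  assumes T: "Vector_Spaces.linear sm sm T" and A: "Vector_Spaces.linear sm sm A"
  shows "convex ((\<lambda>x. ip (T x) (A x)) ` sphere 0 1)"
proof (rule convexI)
  interpret T: Vector_Spaces.linear sm sm T by (rule T)
  interpret A: Vector_Spaces.linear sm sm A by (rule A)
  fix p q and a b :: real
  assume "p \<in> (\<lambda>x. ip (T x) (A x)) ` sphere 0 1" "q \<in> (\<lambda>x. ip (T x) (A x)) ` sphere 0 1"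
  then obtain x y where x: "p = ip (T x) (A x)" "norm x = 1" and y: "q = ip (T y) (A y)" "norm y = 1"
    by auto
  assume ab: "0 \<le> a" "0 \<le> b" "a + b = 1"
  show "a *\<^sub>R p + b *\<^sub>R q \<in> (\<lambda>x. ip (T x) (A x)) ` sphere 0 1"
  proof (cases "p = q")
    case True
    with ab have "a *\<^sub>R p + b *\<^sub>R q = p"
      using scaleR_add_left[of a b p] by simp
    with x show ?thesis by auto
  next
    case False
    \<comment> \<open>An affine change of the values: on unit vectors, subtracting
      \<open>p * ip u v\<close> shifts by \<open>p\<close>, and the division sends \<open>q\<close>
      to 1. The point \<open>a *\<^sub>R p + b *\<^sub>R q\<close> thus corresponds to the value
      \<open>b\<close>.\<close>
    define F where "F = (\<lambda>u v. (ip (T u) (A v) - p * ip u v) / (q - p))"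
    have "F y y = 1"
      using y x False by (simp add: F_def ip_self)
    have "\<exists>u. norm u = 1 \<and> F u u = of_real b"
      by (rule sesquilinear_attains_unit_interval[of F x y])
        (use x y ab \<open>F y y = 1\<close> in \<open>simp_all add: F_def T.add A.add T.scale A.scale ip_add_left ip_add_right
          ip_scale_left ip_scale_right ip_self add_divide_distrib diff_divide_distrib algebra_simps\<close>)
    then obtain u where u: "norm u = 1" "F u u = of_real b"
      by blast
    have "ip (T u) (A u) = p + of_real b * (q - p)"
      using u False by (simp add: F_def ip_self field_simps)
    also have "\<dots> = a *\<^sub>R p + b *\<^sub>R q"
    proof -
      have "a = 1 - b" using ab by simp
      show ?thesis
        unfolding \<open>a = 1 - b\<close> by (simp add: scaleR_conv_of_real algebra_simps)
    qed
    finally show ?thesis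
      using u by (intro image_eqI[of _ _ u]) simp_all
  qed
qed

section \<open>The finite-dimensional case\<close>

text \<open>Induction on the spanning set: a new vector \<open>a\<close> outside
  \<open>span B\<close> has positive distance to it, which bounds the coefficient of
  \<open>a\<close> in any bounded vector.\<close>

lemma compact_span_Int_cball:
  assumes "finite B"
  shows "compact (span B \<inter> cball 0 r)"
  using assms
proof (induction B arbitrary: r rule: finite_induct)
  case empty
  have "span {} \<inter> cball 0 r = {} \<or> span {} \<inter> cball 0 r = {0}"
    by auto
  then show ?case by (metis compact_empty compact_sing)
next
  case (insert a B)
  show ?case
  proof (cases "a \<in> span B")
    case True
    then show ?thesis
      using insert.IH by (simp add: span_redundant)
  next
    case False
    \<comment> \<open>Compactness from the induction hypothesis keeps \<open>a\<close> away from the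
      elements of \<open>span B\<close> of norm at most \<open>norm a + 1\<close>; all others are at
      distance more than 1 by the triangle inequality. Hence the minimum \<open>d\<close>.\<close>
    have "open (- (span B \<inter> cball 0 (norm a + 1)))"
      by (intro open_Compl compact_imp_closed insert.IH)
    with False obtain e where "e > 0" and "ball a e \<subseteq> - (span B \<inter> cball 0 (norm a + 1))"
      using openE[of "- (span B \<inter> cball 0 (norm a + 1))" a] by blast
    then have e: "e \<le> dist a s" if "s \<in> span B \<inter> cball 0 (norm a + 1)" for s
      using that by (force simp: not_less)
    define d where "d = min e 1"
    have "d > 0"
      using \<open>e > 0\<close> by (simp add: d_def)
    have d: "d \<le> norm (a + s)" if "s \<in> span B" for s
    proof (cases "norm s \<le> norm a + 1")
      case True
      then show ?thesis
        using e[of "- s"] that by (simp add: d_def dist_norm span_neg)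
    next
      case False
      have "norm s \<le> norm (a + s) + norm a"
        using norm_triangle_ineq4[of "a + s" a] by simp
      with False show ?thesis by (simp add: d_def)
    qed
    \<comment> \<open>A Minkowski sum of two compact sets, large enough to contain the ball of
      radius \<open>r\<close> in the enlarged span: the coefficient of \<open>a\<close> is at most
      \<open>r / d\<close>, which bounds the remaining summand.\<close>
    define K where "K = {s + t | s t. s \<in> span B \<inter> cball 0 (r + r / d * norm a) \<and>
        t \<in> (\<lambda>k. k \<odot> a) ` cball 0 (r / d)}"
    have "compact K"
      unfolding K_def
      by (intro compact_sums insert.IH compact_continuous_image compact_cball
          linear_continuous_on bounded_linear_scale_left)
    moreover have "span (insert a B) \<inter> cball 0 r = K \<inter> cball 0 r"
    proof (intro equalityI subsetI IntI)
      fix y assume y: "y \<in> span (insert a B) \<inter> cball 0 r"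
      then obtain k where k: "y - k \<odot> a \<in> span B"
        by (auto simp: span_breakdown_eq)
      have kd: "norm k * d \<le> r"
      proof (cases "k = 0")
        case True
        have "0 \<le> r"
          using y order_trans[OF norm_ge_zero[of y]] by simp
        with True show ?thesis by simp
      next
        case False
        \<comment> \<open>Factoring \<open>k\<close> out of \<open>y\<close> leaves \<open>a\<close>
          plus an element of \<open>span B\<close>, whose norm is at least \<open>d\<close>.\<close>
        have "norm k * d \<le> norm k * norm (a + inverse k \<odot> (y - k \<odot> a))"
          using k by (intro mult_left_mono d span_scale) auto
        also have "\<dots> = norm (k \<odot> a + k \<odot> inverse k \<odot> (y - k \<odot> a))"
          by (simp only: norm_scale flip: scale_right_distrib)
        also have "\<dots> = norm y"
          using False by (simp add: scale_right_diff_distrib)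
        finally show ?thesis using y by simp
      qed
      then have k_le: "norm k \<le> r / d"
        using \<open>d > 0\<close> by (simp add: field_simps)
      have "norm (y - k \<odot> a) \<le> norm y + norm k * norm a"
        using norm_triangle_ineq4[of y "k \<odot> a"] by (simp add: norm_scale)
      also have "\<dots> \<le> r + r / d * norm a"
        using y k_le by (intro add_mono mult_right_mono) auto
      finally show "y \<in> K"
        unfolding K_def using k k_le
        by (intro CollectI exI[of _ "y - k \<odot> a"] exI[of _ "k \<odot> a"]) auto
    next
      fix y assume "y \<in> K \<inter> cball 0 r"
      then show "y \<in> span (insert a B)"
        by (auto simp: K_def intro!: span_add span_scale span_base[of a]
            dest: span_mono[THEN subsetD, rotated, of _ B "insert a B"])
    qed auto
    ultimately show ?thesis
      by (auto intro: compact_Int_closed)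
  qed
qed

lemma compact_sphere_if_finite_dimensional:
  assumes "finite_dimensional sm"
  shows "compact (sphere (0::'v) r)"
proof -
  from assms obtain B where "finite_dimensional_vector_space sm B"
    by (auto simp: finite_dimensional_def)
  then have "finite B" "span B = UNIV"
    by (auto simp: finite_dimensional_vector_space_def finite_dimensional_vector_space_axioms_def)
  then have "compact (cball (0::'v) r)"
    using compact_span_Int_cball[of B r] by simp
  then have "compact (cball (0::'v) r \<inter> sphere 0 r)"
    unfolding sphere_def dist_norm
    by (intro compact_Int_closed closed_Collect_eq continuous_intros)
  moreover have "cball (0::'v) r \<inter> sphere 0 r = sphere 0 r"
    by auto
  ultimately show ?thesis by simp
qed

text \<open>The operators carry their own scalar multiplication \<open>smB\<close>, specified
  pointwise, so that the real and the complex one on \<open>blinfun\<close> can both be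
  inserted.\<close>

lemma orthogonality_set_nonempty:
  fixes T A :: "'v \<Rightarrow>\<^sub>L 'v"
  assumes smB: "\<And>c (S :: 'v \<Rightarrow>\<^sub>L 'v) x. blinfun_apply (smB c S) x = c \<odot> blinfun_apply S x"
    and fin: "finite_dimensional sm" and nz: "\<exists>x::'v. x \<noteq> 0"
    and T: "Vector_Spaces.linear sm sm (blinfun_apply T)"
    and A: "Vector_Spaces.linear sm sm (blinfun_apply A)"
    and bj: "birkhoff_james_orthogonal smB T A"
  shows "orthogonality_set sm T A \<noteq> {}"
proof
  assume empty: "orthogonality_set sm T A = {}"
  define W where "W = (\<lambda>x. ip (T x) (A x)) ` sphere 0 1"
  have "convex W"
    unfolding W_def using T A by (rule Toeplitz_Hausdorff)
  moreover have "closed W"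
    unfolding W_def
    by (intro compact_imp_closed compact_continuous_image
        compact_sphere_if_finite_dimensional[OF fin]
        bounded_bilinear.continuous_on[OF bounded_bilinear_ip] continuous_intros)
  moreover have "0 \<notin> W"
    using empty by (auto simp: W_def orthogonality_set_def birkhoff_james_orthogonal_iff)
  ultimately obtain a b where "b > 0" and ab: "\<And>w. w \<in> W \<Longrightarrow> b < a \<bullet> w"
    using separating_hyperplane_closed_0 by metis
  \<comment> \<open>Perturbing \<open>T\<close> by \<open>- t *\<^sub>R a\<close> times
    \<open>A\<close> gains at least \<open>2 * t * b\<close> in the squared norm at unit vectors and
    costs at most \<open>t\<^sup>2 * m\<close>. The choice of \<open>t\<close> makes the cost at
    most \<open>t * b\<close>, half of the gain.\<close>
  define m where "m = (norm a)\<^sup>2 * (norm A)\<^sup>2"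
  define t where "t = b / (m + 1)"
  have "m \<ge> 0" by (simp add: m_def)
  with \<open>b > 0\<close> have "t > 0" by (simp add: t_def)
  have "t * m \<le> b"
    using \<open>m \<ge> 0\<close> \<open>b > 0\<close> by (simp add: t_def field_simps)
  define S where "S = T + smB (- t *\<^sub>R a) A"
  define e where "e = (norm T)\<^sup>2 - t * b"
  have bound: "(norm (S x))\<^sup>2 \<le> e" if "norm x = 1" for x
  proof -
    have "norm (T x) \<le> norm T" "norm (A x) \<le> norm A"
      using norm_blinfun[of T x] norm_blinfun[of A x] that by simp_all
    then have le: "(norm (T x))\<^sup>2 \<le> (norm T)\<^sup>2" "(norm (A x))\<^sup>2 \<le> (norm A)\<^sup>2"
      by (simp_all add: power_mono)
    have "(norm (T x + (- t *\<^sub>R a) \<odot> A x))\<^sup>2 = (norm (T x))\<^sup>2 - 2 * t * (a \<bullet> ip (T x) (A x))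
        + t\<^sup>2 * ((norm a)\<^sup>2 * (norm (A x))\<^sup>2)"
      unfolding norm_add_scale_power2 by (simp add: power_mult_distrib)
    also have "\<dots> \<le> (norm T)\<^sup>2 - 2 * t * b + t\<^sup>2 * m"
      unfolding m_def
      using le ab[of "ip (T x) (A x)"] that \<open>t > 0\<close>
      by (intro add_mono diff_mono mult_left_mono) (auto simp: W_def)
    also have "\<dots> \<le> (norm T)\<^sup>2 - 2 * t * b + t * b"
      using \<open>t * m \<le> b\<close> \<open>t > 0\<close> by (simp add: power2_eq_square mult.assoc)
    finally show ?thesis by (simp add: e_def S_def blinfun.add_left smB mult.commute)
  qed
  \<comment> \<open>A nonzero space has a unit vector, and \<open>bound\<close> at it gives
    \<open>e \<ge> 0\<close>, so that \<open>sqrt e\<close> can serve as a norm bound.\<close>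
  from nz obtain x0 :: 'v where "x0 \<noteq> 0" by blast
  have "0 \<le> (norm (S ((1 / norm x0) *\<^sub>R x0)))\<^sup>2" by simp
  also have "\<dots> \<le> e"
    by (rule bound) (simp add: \<open>x0 \<noteq> 0\<close>)
  finally have "e \<ge> 0" .
  have "norm S \<le> sqrt e"
  proof (rule norm_blinfun_bound)
    fix x :: 'v
    show "norm (S x) \<le> sqrt e * norm x"
    proof (cases "x = 0")
      case False
      have "norm (S ((1 / norm x) *\<^sub>R x)) \<le> sqrt e"
        by (rule real_le_rsqrt, rule bound) (simp add: False)
      with False show ?thesis
        by (simp add: blinfun.scaleR_right field_simps)
    qed simp
  qed (use \<open>e \<ge> 0\<close> in simp)
  moreover have "norm T \<le> norm S"
    using bj by (simp add: birkhoff_james_orthogonal_def S_def)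
  ultimately have "(norm T)\<^sup>2 \<le> (sqrt e)\<^sup>2"
    by (intro power_mono) auto
  with \<open>e \<ge> 0\<close> mult_pos_pos[OF \<open>t > 0\<close> \<open>b > 0\<close>] show False
    by (simp add: e_def)
qed

end

section \<open>The infinite-dimensional case\<close>

text \<open>
  The sort of the theorem does not entail \<open>banach\<close>, so the library's comparison test does
  not apply.
\<close>

lemma summable_dominated:
  fixes f :: "nat \<Rightarrow> 'v::{real_normed_vector,complete_space}"
  assumes le: "\<And>n. norm (f n) \<le> g n" and g: "summable g"
  shows "summable f" and "norm (suminf f) \<le> suminf g"
proof -
  have dist: "dist (sum f {..<m}) (sum f {..<n}) \<le> dist (sum g {..<m}) (sum g {..<n})" for m n
  proof -
    have *: "dist (sum f {..<m}) (sum f {..<n}) \<le> dist (sum g {..<m}) (sum g {..<n})"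
      if "m \<le> n" for m n
    proof -
      have "norm (sum f {m..<n}) \<le> sum g {m..<n}"
        by (intro order_trans[OF norm_sum] sum_mono le)
      also have "\<dots> \<le> norm (sum g {m..<n})" by simp
      finally have "norm (sum f {m..<n}) \<le> norm (sum g {m..<n})" .
      moreover have "dist (sum h {..<m}) (sum h {..<n}) = norm (sum h {m..<n})"
        for h :: "nat \<Rightarrow> 'c::real_normed_vector"
        using that sum_diff_nat_ivl[of 0 m n h]
        by (subst dist_commute) (simp add: dist_norm lessThan_atLeast0)
      ultimately show ?thesis
        by metis
    qed
    show ?thesis
      using *[of m n] *[of n m] by (cases "m \<le> n") (auto simp: dist_commute)
  qed
  have "Cauchy (\<lambda>n. sum g {..<n})"
    using g by (simp add: summable_iff_convergent Cauchy_convergent_iff)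
  then have "Cauchy (\<lambda>n. sum f {..<n})"
    unfolding Cauchy_def by (meson dist le_less_trans)
  then show "summable f"
    by (simp add: summable_iff_convergent Cauchy_convergent_iff)
  then have "(\<lambda>n. sum f {..<n}) \<longlonglongrightarrow> suminf f"
    by (rule summable_LIMSEQ)
  moreover have "norm (sum f {..<n}) \<le> suminf g" for n
  proof -
    have "norm (sum f {..<n}) \<le> sum g {..<n}"
      by (intro order_trans[OF norm_sum] sum_mono le)
    also have "\<dots> \<le> suminf g"
      using g by (rule sum_le_suminf) (auto intro: order_trans[OF norm_ge_zero le])
    finally show ?thesis .
  qed
  ultimately show "norm (suminf f) \<le> suminf g"
    by (intro Lim_bounded[OF tendsto_norm]) auto
qed

section \<open>Spanning sets and common kernels of finitely many functionals\<close>

context vector_space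
begin

lemma finite_dimensional_if_spanned:
  assumes "finite F" "span F = UNIV"
  shows "finite_dimensional scale"
proof -
  obtain B where B: "B \<subseteq> F" "independent B" "F \<subseteq> span B"
    using maximal_independent_subset by blast
  then have "span B = UNIV"
    using assms by (metis span_mono span_span top.extremum_unique)
  with B assms have "finite_dimensional_vector_space scale B"
    by unfold_locales (auto intro: finite_subset)
  then show ?thesis
    by (auto simp: finite_dimensional_def)
qed

text \<open>Each further functional costs at most one more spanning vector: either it vanishes on
  the common kernel so far, or some \<open>p\<close> in that kernel with \<open>f j p\<close>
  nonzero can be used to correct its value without disturbing the others.\<close>

lemma finite_codimension_common_kernel:
  fixes f :: "'i \<Rightarrow> 'b \<Rightarrow> 'a"
  assumes "finite I" and "\<And>i. i \<in> I \<Longrightarrow> Vector_Spaces.linear scale (*) (f i)"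
  shows "\<exists>F. finite F \<and> (\<forall>x. \<exists>s\<in>span F. \<forall>i\<in>I. f i (x - s) = 0)"
  using assms
proof (induction I rule: finite_induct)
  case empty
  show ?case by (rule exI[of _ "{}"]) simp
next
  case (insert j I)
  then obtain F where F: "finite F" "\<And>x. \<exists>s\<in>span F. \<forall>i\<in>I. f i (x - s) = 0"
    by auto
  show ?case
  proof (cases "\<exists>p. f j p \<noteq> 0 \<and> (\<forall>i\<in>I. f i p = 0)")
    case False
    with F show ?thesis by (intro exI[of _ F]) (metis insert_iff)
  next
    case True
    then obtain p where p: "f j p \<noteq> 0" "\<And>i. i \<in> I \<Longrightarrow> f i p = 0" by blast
    have "\<exists>s\<in>span (insert p F). \<forall>i\<in>insert j I. f i (x - s) = 0" for x
    proof -
      from F obtain s where s: "s \<in> span F" "\<And>i. i \<in> I \<Longrightarrow> f i (x - s) = 0" by blast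
      define c where "c = f j (x - s) / f j p"
      have "f i (x - (s + scale c p)) = f i (x - s) - c * f i p" if "i \<in> insert j I" for i
      proof -
        interpret f: Vector_Spaces.linear scale "(*)" "f i"
          using that insert.prems by auto
        show ?thesis by (simp add: f.diff f.add f.scale)
      qed
      then have "\<forall>i\<in>insert j I. f i (x - (s + scale c p)) = 0"
        using p s by (auto simp: c_def)
      moreover have "s + scale c p \<in> span (insert p F)"
        using s span_mono[of F "insert p F"]
        by (intro span_add span_scale[OF span_base]) (auto simp: subset_insertI)
      ultimately show ?thesis by blast
    qed
    with F show ?thesis by (intro exI[of _ "insert p F"]) simp
  qed
qed

end

section \<open>The operator built from a dense sequence\<close>

context hilbert_space
begin

text \<open>If the common kernel of the functionals \<open>ip x (d i)\<close> were zero, the finite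
  set from \<open>finite_codimension_common_kernel\<close> would span the space.\<close>

lemma exists_unit_orthogonal:
  assumes "\<not> finite_dimensional sm" "finite I"
  obtains x where "norm x = 1" "\<And>i. i \<in> I \<Longrightarrow> ip x (d i) = 0"
proof -
  have "Vector_Spaces.linear sm (*) (\<lambda>x. ip x (d i))" for i
    by unfold_locales (simp_all add: ip_add_left ip_scale_left algebra_simps)
  then obtain F where F: "finite F" "\<And>x. \<exists>s\<in>span F. \<forall>i\<in>I. ip (x - s) (d i) = 0"
    using finite_codimension_common_kernel[OF assms(2), of "\<lambda>i x. ip x (d i)"] by blast
  have "span F \<noteq> UNIV"
    using finite_dimensional_if_spanned F assms by blast
  then obtain v where "v \<notin> span F" by blast
  with F obtain s where s: "v \<noteq> s" "\<And>i. i \<in> I \<Longrightarrow> ip (v - s) (d i) = 0" by metis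
  show ?thesis
    by (rule that[of "(1 / norm (v - s)) *\<^sub>R (v - s)"])
      (use s in \<open>simp, simp add: scaleR_eq_scale ip_scale_left\<close>)
qed

text \<open>The sequence \<open>d\<close> need be neither bounded nor orthogonal: the denominator
  absorbs the size of \<open>d n\<close>, and the geometric factor makes the series converge
  absolutely.\<close>

definition weighted_term :: "(nat \<Rightarrow> 'v) \<Rightarrow> 'v \<Rightarrow> nat \<Rightarrow> 'v"
  where "weighted_term d x n = ((1/2)^n / (1 + (norm (d n))\<^sup>2)) *\<^sub>R (ip x (d n) \<odot> d n)"

lemma norm_weighted_term_le: "norm (weighted_term d x n) \<le> (1/2)^n * norm x"
proof -
  have "norm (ip x (d n) \<odot> d n) \<le> norm x * (norm (d n))\<^sup>2"
    using mult_right_mono[OF Cauchy_Schwarz[of x "d n"], of "norm (d n)"]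
    by (simp add: norm_scale power2_eq_square mult.assoc)
  also have "\<dots> \<le> norm x * (1 + (norm (d n))\<^sup>2)"
    by (intro mult_left_mono) auto
  finally have *: "norm (ip x (d n) \<odot> d n) \<le> norm x * (1 + (norm (d n))\<^sup>2)" .
  have pos: "1 + (norm (d n))\<^sup>2 > 0"
    by (simp add: add_pos_nonneg)
  have "norm (weighted_term d x n) = (1/2)^n / (1 + (norm (d n))\<^sup>2) * norm (ip x (d n) \<odot> d n)"
    using pos by (simp add: weighted_term_def)
  also have "\<dots> \<le> (1/2)^n / (1 + (norm (d n))\<^sup>2) * (norm x * (1 + (norm (d n))\<^sup>2))"
    using * pos by (intro mult_left_mono) auto
  also have "\<dots> = (1/2)^n * norm x"
    using pos by simp
  finally show ?thesis .
qed

lemma summable_geometric_half: "summable (\<lambda>n. (1/2)^n * c :: real)"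
  by (intro summable_mult2 summable_geometric) simp

lemma weighted_term_sums: "weighted_term d x sums suminf (weighted_term d x)"
  by (rule summable_sums, rule summable_dominated(1)[OF norm_weighted_term_le summable_geometric_half])

lemma weighted_term_scale: "weighted_term d (c \<odot> x) n = c \<odot> weighted_term d x n"
  by (simp add: weighted_term_def scaleR_eq_scale ip_scale_left mult.left_commute)

lemma weighted_term_add: "weighted_term d (x + y) n = weighted_term d x n + weighted_term d y n"
  by (simp add: weighted_term_def ip_add_left scale_left_distrib scaleR_add_right)

lemma suminf_weighted_term_scale:
  "suminf (weighted_term d (c \<odot> x)) = c \<odot> suminf (weighted_term d x)"
  using bounded_linear.sums[OF bounded_linear_scale_right weighted_term_sums, of c d x]
  by (intro sums_unique[symmetric]) (simp add: weighted_term_scale[abs_def] sums_def)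

lemma suminf_weighted_term_add:
  "suminf (weighted_term d (x + y)) = suminf (weighted_term d x) + suminf (weighted_term d y)"
  using sums_add[OF weighted_term_sums[of d x] weighted_term_sums[of d y]]
  by (intro sums_unique[symmetric]) (simp add: weighted_term_add[abs_def])

lemma bounded_linear_suminf_weighted_term: "bounded_linear (\<lambda>x. suminf (weighted_term d x))"
proof (rule bounded_linear_intro)
  show "norm (suminf (weighted_term d x)) \<le> norm x * 2" for x
  proof -
    have "norm (suminf (weighted_term d x)) \<le> (\<Sum>n. (1/2)^n * norm x)"
      by (rule summable_dominated(2)[OF norm_weighted_term_le summable_geometric_half])
    also have "\<dots> = norm x * 2"
      by (simp add: suminf_mult2[symmetric] summable_geometric suminf_geometric)
    finally show ?thesis .
  qed
qed (simp_all add: suminf_weighted_term_add suminf_weighted_term_scale scaleR_eq_scale)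

text \<open>Pairing the series with \<open>x\<close> gives nonnegative multiples of the squared
  norms of \<open>ip x (d n)\<close>. A zero sum forces \<open>x\<close> to be orthogonal to every
  \<open>d n\<close>, hence to a dense set.\<close>

lemma suminf_weighted_term_definite:
  assumes dense: "closure (range d) = UNIV" and 0: "ip (suminf (weighted_term d x)) x = 0"
  shows "x = 0"
proof -
  define h where "h n = (1/2)^n / (1 + (norm (d n))\<^sup>2) * (norm (ip x (d n)))\<^sup>2" for n
  have h: "ip (weighted_term d x n) x = of_real (h n)" for n
  proof -
    have "ip x (d n) * ip (d n) x = of_real ((norm (ip x (d n)))\<^sup>2)"
      by (metis ip_commute mult_cj)
    then show ?thesis
      by (simp only: weighted_term_def scaleR_eq_scale ip_scale_left h_def of_real_mult)
  qed
  have "(\<lambda>n. ip (weighted_term d x n) x) sums 0"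
    using bounded_linear.sums[OF bounded_bilinear.bounded_linear_left[OF bounded_bilinear_ip, of x]
        weighted_term_sums, of d x] 0 by simp
  then have "(\<lambda>n. of_real (h n) :: 'k) sums of_real 0"
    by (simp add: h)
  then have "h sums 0"
    by (simp only: sums_of_real_iff)
  moreover have "h n \<ge> 0" for n
    by (simp add: h_def)
  ultimately have "h n = 0" for n
    using suminf_eq_zero_iff[of h] sums_iff[of h 0] by auto
  then have orth: "ip x (d n) = 0" for n
    using add_pos_nonneg[of 1 "(norm (d n))\<^sup>2"]
    by (auto simp: h_def add_nonneg_eq_0_iff)
  show "x = 0"
  proof (rule ccontr)
    assume "x \<noteq> 0"
    have "x \<in> closure (range d)"
      using dense by simp
    then obtain n where n: "dist (d n) x < norm x"
      using \<open>x \<noteq> 0\<close> unfolding closure_approachable by (metis rangeE zero_less_norm_iff)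
    \<comment> \<open>By orthogonality to \<open>d n\<close>, Cauchy-Schwarz yields
      \<open>norm x \<le> norm (x - d n)\<close>, against the choice of \<open>n\<close>.\<close>
    have "ip x (x - d n) = ip x x"
      using ip_add_right[of x "x - d n" "d n"] orth by simp
    then have "norm x * norm x \<le> norm x * norm (x - d n)"
      using Cauchy_Schwarz[of x "x - d n"] by (simp add: ip_self power2_eq_square norm_mult)
    with n \<open>x \<noteq> 0\<close> show False
      by (simp add: dist_norm norm_minus_commute)
  qed
qed

text \<open>A unit vector orthogonal to the first \<open>N\<close> members of \<open>d\<close> loses
  the first \<open>N\<close> terms; what remains is bounded by a geometric tail.\<close>

lemma suminf_weighted_term_small:
  assumes "\<not> finite_dimensional sm" "e > 0"
  obtains x where "norm x = 1" "norm (suminf (weighted_term d x)) < e"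
proof -
  obtain N where N: "norm (\<Sum>i. (1/2)^(i+N) * 1 :: real) < e"
    using suminf_exist_split[OF assms(2) summable_geometric_half[of 1]] by blast
  obtain x where x: "norm x = 1" "\<And>i. i \<in> {..<N} \<Longrightarrow> ip x (d i) = 0"
    using exists_unit_orthogonal[OF assms(1), of "{..<N}" d] by auto
  have "suminf (weighted_term d x) = (\<Sum>i. weighted_term d x (i + N)) + sum (weighted_term d x) {..<N}"
    by (rule suminf_split_initial_segment) (rule sums_summable[OF weighted_term_sums])
  also have "sum (weighted_term d x) {..<N} = 0"
    using x by (simp add: weighted_term_def)
  finally have eq: "suminf (weighted_term d x) = (\<Sum>i. weighted_term d x (i + N))" by simp
  have "norm (suminf (weighted_term d x)) \<le> (\<Sum>i. (1/2)^(i+N) * 1)"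
    unfolding eq
  proof (rule summable_dominated(2))
    show "norm (weighted_term d x (n + N)) \<le> (1/2)^(n+N) * 1" for n
      using norm_weighted_term_le[of d x "n + N"] x by simp
    show "summable (\<lambda>n. (1/2)^(n+N) * 1 :: real)"
      using summable_geometric_half[of 1] by (subst summable_iff_shift)
  qed
  also have "\<dots> < e"
    using N by (simp del: mult_1_right)
  finally show ?thesis
    using x that by blast
qed

lemma exists_orthogonal_with_empty_orthogonality_set:
  assumes smB: "\<And>c (S :: 'v \<Rightarrow>\<^sub>L 'v) x. blinfun_apply (smB c S) x = c \<odot> blinfun_apply S x"
    and inf: "\<not> finite_dimensional sm" and sep: "separable_space (euclidean :: 'v topology)"
  obtains T A :: "'v \<Rightarrow>\<^sub>L 'v" where
    "Vector_Spaces.linear sm sm (blinfun_apply T)" "Vector_Spaces.linear sm sm (blinfun_apply A)"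
    "birkhoff_james_orthogonal smB T A" "orthogonality_set sm T A = {}"
proof -
  from sep obtain C :: "'v set" where C: "countable C" "closure C = UNIV"
    by (auto simp: separable_space_def)
  then have "C \<noteq> {}" by auto
  define d where "d = from_nat_into C"
  have dense: "closure (range d) = UNIV"
    using C \<open>C \<noteq> {}\<close> by (simp add: d_def range_from_nat_into)
  define A where "A = Blinfun (\<lambda>x. suminf (weighted_term d x))"
  have A: "A x = suminf (weighted_term d x)" for x
    by (simp add: A_def bounded_linear_Blinfun_apply bounded_linear_suminf_weighted_term)
  have "birkhoff_james_orthogonal smB id_blinfun A"
    unfolding birkhoff_james_orthogonal_def
  proof
    fix c
    \<comment> \<open>At a unit vector \<open>x\<close> with \<open>A x\<close> this small, the
      perturbation \<open>c \<odot> A x\<close> has norm at most \<open>e\<close>. The summand 1 in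
      the denominator covers \<open>c = 0\<close>.\<close>
    have "1 \<le> norm (id_blinfun + smB c A) + e" if "e > 0" for e
    proof -
      have "e / (norm c + 1) > 0"
        using that by (simp add: add_nonneg_pos)
      then obtain x where x: "norm x = 1" "norm (A x) < e / (norm c + 1)"
        using suminf_weighted_term_small[OF inf] by (metis A)
      have "(norm c + 1) * norm (A x) < e"
        using x(2) by (simp add: pos_less_divide_eq add_nonneg_pos mult.commute)
      then have "norm (c \<odot> A x) \<le> e"
        using norm_ge_zero[of "A x"] by (simp add: norm_scale algebra_simps del: norm_ge_zero)
      moreover have "norm x \<le> norm (x + c \<odot> A x) + norm (c \<odot> A x)"
        using norm_triangle_ineq4[of "x + c \<odot> A x" "c \<odot> A x"] by simp
      moreover have "norm (x + c \<odot> A x) \<le> norm (id_blinfun + smB c A)"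
        using norm_blinfun[of "id_blinfun + smB c A" x] x by (simp add: blinfun.add_left smB)
      ultimately show ?thesis
        using x by simp
    qed
    then have "1 \<le> norm (id_blinfun + smB c A)"
      by (rule field_le_epsilon)
    then show "norm (id_blinfun :: 'v \<Rightarrow>\<^sub>L 'v) \<le> norm (id_blinfun + smB c A)"
      using norm_blinfun_id_le order_trans by blast
  qed
  moreover have "orthogonality_set sm id_blinfun A = {}"
  proof -
    have "x = 0" if "ip x (A x) = 0" for x
      using that suminf_weighted_term_definite[OF dense, of x] ip_commute[of "A x" x]
      by (simp add: A cj_0)
    then show ?thesis
      by (force simp: orthogonality_set_def birkhoff_james_orthogonal_iff)
  qed
  moreover have "Vector_Spaces.linear sm sm (blinfun_apply id_blinfun)"
    by unfold_locales (simp_all add: scale_right_distrib)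
  moreover have "Vector_Spaces.linear sm sm (blinfun_apply A)"
    by unfold_locales (simp_all add: A suminf_weighted_term_add suminf_weighted_term_scale)
  ultimately show ?thesis
    by (rule that[rotated 2])
qed

theorem finite_dimensional_iff_orthogonality_set:
  assumes smB: "\<And>c (S :: 'v \<Rightarrow>\<^sub>L 'v) x. blinfun_apply (smB c S) x = c \<odot> blinfun_apply S x"
    and nz: "\<exists>x::'v. x \<noteq> 0" and sep: "separable_space (euclidean :: 'v topology)"
  shows "finite_dimensional sm \<longleftrightarrow>
    (\<forall>T A :: 'v \<Rightarrow>\<^sub>L 'v. Vector_Spaces.linear sm sm (blinfun_apply T) \<longrightarrow>
      Vector_Spaces.linear sm sm (blinfun_apply A) \<longrightarrow>
      birkhoff_james_orthogonal smB T A \<longrightarrow> orthogonality_set sm T A \<noteq> {})"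
  using orthogonality_set_nonempty[OF smB _ nz]
    exists_orthogonal_with_empty_orthogonality_set[OF smB _ sep]
  by metis

end

section \<open>The real and complex instances\<close>

lemma hilbert_space_real:
  "hilbert_space ((*\<^sub>R) :: real \<Rightarrow> 'a::{real_inner,complete_space} \<Rightarrow> 'a) id inner"
  by unfold_locales
    (auto simp: dot_square_norm inner_add_left scaleR_add_right scaleR_add_left Reals_def
      power2_eq_square[of "_ :: real", symmetric] intro: inner_commute)

lemma hilbert_space_complex:
  "hilbert_space ((*\<^sub>C) :: complex \<Rightarrow> 'b::{complex_inner,complete_space} \<Rightarrow> 'b) cnj cinner"
proof -
  interpret vector_space "(*\<^sub>C) :: complex \<Rightarrow> 'b \<Rightarrow> 'b"
    by (rule vector_space_scaleC)
  show ?thesis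
    by unfold_locales
      (simp_all add: complex_norm_square[symmetric] Reals_cnj_iff cinner_add_left cinner_scaleC_left
        cinner_self norm_scaleC scaleR_scaleC cinner_commute[symmetric])
qed

theorem theorem3p4:
  shows
    "((\<exists>x::'a::{real_inner,complete_space}. x \<noteq> 0) \<and> separable_space (euclidean :: 'a topology) \<longrightarrow>
        (finite_dimensional ((*\<^sub>R) :: real \<Rightarrow> 'a \<Rightarrow> 'a) \<longleftrightarrow>
          (\<forall>T A :: 'a \<Rightarrow>\<^sub>L 'a.
            birkhoff_james_orthogonal (*\<^sub>R) T A \<longrightarrow>
            orthogonality_set (*\<^sub>R) T A \<noteq> {})))
     \<and>
     ((\<exists>x::'b::{complex_inner,complete_space}. x \<noteq> 0) \<and> separable_space (euclidean :: 'b topology) \<longrightarrow>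
        (finite_dimensional ((*\<^sub>C) :: complex \<Rightarrow> 'b \<Rightarrow> 'b) \<longleftrightarrow>
          (\<forall>T A :: 'b \<Rightarrow>\<^sub>L 'b.
            Vector_Spaces.linear (*\<^sub>C) (*\<^sub>C) (blinfun_apply T) \<longrightarrow>
            Vector_Spaces.linear (*\<^sub>C) (*\<^sub>C) (blinfun_apply A) \<longrightarrow>
            birkhoff_james_orthogonal (*\<^sub>C) T A \<longrightarrow>
            orthogonality_set (*\<^sub>C) T A \<noteq> {})))"
proof (intro conjI impI; elim conjE)
  interpret hilbert_space "(*\<^sub>R) :: real \<Rightarrow> 'a \<Rightarrow> 'a" id inner
    by (rule hilbert_space_real)
  assume "\<exists>x::'a. x \<noteq> 0" "separable_space (euclidean :: 'a topology)"
  \<comment> \<open>Over the reals every element of \<open>blinfun\<close> is linear, so the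
    linearity premises of the general theorem disappear.\<close>
  moreover have "Vector_Spaces.linear (*\<^sub>R) (*\<^sub>R) (blinfun_apply T)" for T :: "'a \<Rightarrow>\<^sub>L 'a"
    using bounded_linear.linear[OF blinfun.bounded_linear_right[of T]]
    by (simp add: linear_def)
  ultimately show "finite_dimensional ((*\<^sub>R) :: real \<Rightarrow> 'a \<Rightarrow> 'a) \<longleftrightarrow>
      (\<forall>T A :: 'a \<Rightarrow>\<^sub>L 'a. birkhoff_james_orthogonal (*\<^sub>R) T A \<longrightarrow>
        orthogonality_set (*\<^sub>R) T A \<noteq> {})"
    using finite_dimensional_iff_orthogonality_set[of "(*\<^sub>R)"] by (simp add: blinfun.scaleR_left)
next
  interpret hilbert_space "(*\<^sub>C) :: complex \<Rightarrow> 'b \<Rightarrow> 'b" cnj cinner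
    by (rule hilbert_space_complex)
  assume "\<exists>x::'b. x \<noteq> 0" "separable_space (euclidean :: 'b topology)"
  then show "finite_dimensional ((*\<^sub>C) :: complex \<Rightarrow> 'b \<Rightarrow> 'b) \<longleftrightarrow>
      (\<forall>T A :: 'b \<Rightarrow>\<^sub>L 'b. Vector_Spaces.linear (*\<^sub>C) (*\<^sub>C) (blinfun_apply T) \<longrightarrow>
        Vector_Spaces.linear (*\<^sub>C) (*\<^sub>C) (blinfun_apply A) \<longrightarrow>
        birkhoff_james_orthogonal (*\<^sub>C) T A \<longrightarrow> orthogonality_set (*\<^sub>C) T A \<noteq> {})"
    using finite_dimensional_iff_orthogonality_set[of "(*\<^sub>C)"] by (simp add: scaleC_blinfun.rep_eq)
qed

end
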